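(* For any two patterns $v_1$ and $v_2$, if $f_0^{v_1}([k]^n)=f_0^{v_2}([k]^n)$ for all $k,n\in\mathbb{N}$, then $f_0^{v_1}(\mathcal{S}_n)=f_0^{v_2}(\mathcal{S}_n)$ for all $n\in\mathbb{N}$. The converse does not hold: there exist patterns $v_1,v_2$ such that $f_0^{v_1}(\mathcal{S}_n)=f_0^{v_2}(\mathcal{S}_n)$ for all $n\in\mathbb{N}$, but $f_0^{v_1}([k]^n)\ne f_0^{v_2}([k]^n)$ for some $k,n\in\mathbb{N}$.
   Context: $\mathbb{N}=\{1,2,3,\dots\}$ and $[k]=\{1,\dots,k\}$. The set $[k]^n$ is the set of words $w=w_1\cdots w_n$ of length $n$ with letters in $[k]$, and $\mathcal{S}_n\subset[n]^n$ is the set of permutations of length $n$, i.e. rearrangements of $12\cdots n$. A pattern $v=v_1\cdots v_\ell$ is a word of length $\ell\ge2$ with positive integer letters (possibly repeated). An occurrence of $v$ in a word $w$ of length $n$ is a sequence of indices $1\le j_1<\dots<j_\ell\le n$ such that for all $1\le p,q\le\ell$: $w_{j_p}<w_{j_q}\iff v_p<v_q$, and $w_{j_p}=w_{j_q}\iff v_p=v_q$. For a set $A$ of words, $f_0^v(A)$ is the number of words in $A$ having no occurrence of $v$. *)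

theory Defs
  imports Main "HOL-Combinatorics.Multiset_Permutations"
begin

definition words :: "nat \<Rightarrow> nat \<Rightarrow> nat list set" where
  "words k n = {w. length w = n \<and> set w \<subseteq> {1..k}}"

definition perms :: "nat \<Rightarrow> nat list set" where
  "perms n = permutations_of_set {1..n}"

definition is_pattern :: "nat list \<Rightarrow> bool" where
  "is_pattern v \<longleftrightarrow> 2 \<le> length v \<and> (\<forall>x\<in>set v. 1 \<le> x)"

(* The sequence of indices is a strictly increasing list js; positions are
   counted from 0, as list indexing requires. *)
definition occurrence :: "nat list \<Rightarrow> nat list \<Rightarrow> nat list \<Rightarrow> bool" where
  "occurrence v w js \<longleftrightarrow>
     length js = length v \<and> sorted_wrt (<) js \<and> set js \<subseteq> {..<length w} \<and>
     (\<forall>p<length v. \<forall>q<length v.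
        (w ! (js ! p) < w ! (js ! q) \<longleftrightarrow> v ! p < v ! q) \<and>
        (w ! (js ! p) = w ! (js ! q) \<longleftrightarrow> v ! p = v ! q))"

definition f0 :: "nat list \<Rightarrow> nat list set \<Rightarrow> nat" where
  "f0 v A = card {w \<in> A. \<not> (\<exists>js. occurrence v w js)}"

end

theory Submission
  imports Defs "HOL-Library.Infinite_Set"
begin

text \<open>Classify the avoiding words over \<open>{1..k}\<close> by the set of letters they actually use. Avoidance is
  invariant under order isomorphism, so the number of avoiders with letter set \<open>S\<close> depends only
  on \<open>card S\<close>; hence the counts for all words determine, by induction on \<open>k\<close>, the counts of
  avoiders with letter set exactly \<open>{1..k}\<close>, and for length \<open>k\<close> these are the permutations.
  The converse fails for \<open>11\<close> and \<open>111\<close>: every permutation avoids both, but the word \<open>11\<close>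
  avoids only the second.\<close>

text \<open>\<open>S\<close> is an arbitrary set because the letters used by a word over
  \<open>{1..k}\<close> may leave gaps.\<close>

definition onto_avoiders :: "nat list \<Rightarrow> nat set \<Rightarrow> nat \<Rightarrow> nat list set" where
  "onto_avoiders v S n = {w. length w = n \<and> set w = S \<and> \<not> (\<exists>js. occurrence v w js)}"

lemma finite_onto_avoiders:
  assumes "finite S"
  shows "finite (onto_avoiders v S n)"
  by (rule finite_subset[OF _ finite_lists_length_eq[OF assms, of n]])
    (auto simp: onto_avoiders_def)

text \<open>On a linear order a strictly increasing map also reflects \<open><\<close> and
  \<open>=\<close>, and an occurrence only compares letters of \<open>u\<close>. So the same
  \<open>js\<close> serves both words.\<close>

lemma occurrence_map_strict_mono:
  assumes "strict_mono_on (set u) f"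
  shows "occurrence v (map f u) js \<longleftrightarrow> occurrence v u js"
proof -
  have nth: "js ! p < length u"
    if "length js = length v" "set js \<subseteq> {..<length u}" "p < length v" for p
    using that nth_mem[of p js] by (metis lessThan_iff subsetD)
  have less: "f (u ! i) < f (u ! j) \<longleftrightarrow> u ! i < u ! j"
    and eq: "f (u ! i) = f (u ! j) \<longleftrightarrow> u ! i = u ! j"
    if "i < length u" "j < length u" for i j
    using that assms by (simp_all add: strict_mono_on_less strict_mono_on_eq)
  show ?thesis
    unfolding occurrence_def using nth by (auto simp: less eq)
qed

lemma card_onto_avoiders_image:
  assumes f: "strict_mono_on S f"
  shows "card (onto_avoiders v (f ` S) n) = card (onto_avoiders v S n)"
proof -
  have inj: "inj_on f S"
    using f by (rule strict_mono_on_imp_inj_on)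
  have occ: "occurrence v (map f u) js \<longleftrightarrow> occurrence v u js" if "set u = S" for u js
    using occurrence_map_strict_mono f that by blast
  have "w \<in> map f ` onto_avoiders v S n" if w: "w \<in> onto_avoiders v (f ` S) n" for w
  proof -
    \<comment> \<open>Undoing the relabelling letter by letter gives the preimage of
      \<open>w\<close>.\<close>
    let ?u = "map (inv_into S f) w"
    have w_eq: "w = map f ?u" and "set ?u = S"
      using w inj by (auto simp: onto_avoiders_def f_inv_into_f intro!: map_idI[symmetric])
    with w occ[of ?u] show ?thesis
      by (intro image_eqI[of _ _ ?u]) (auto simp: onto_avoiders_def)
  qed
  then have "onto_avoiders v (f ` S) n = map f ` onto_avoiders v S n"
    by (auto simp: onto_avoiders_def occ)
  moreover have "inj_on (map f) (onto_avoiders v S n)"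
    using inj by (intro inj_on_mapI) (auto simp: onto_avoiders_def inj_on_def)
  ultimately show ?thesis
    by (simp add: card_image)
qed

text \<open>Both sets are increasing images of the same initial segment of the naturals.\<close>

lemma card_onto_avoiders_cong:
  assumes "finite S" "finite T" "card S = card T"
  shows "card (onto_avoiders v S n) = card (onto_avoiders v T n)"
proof -
  obtain g h where "bij_betw g {..<card S} S" "strict_mono_on {..<card S} g"
    and "bij_betw h {..<card T} T" "strict_mono_on {..<card T} h"
    using ex_bij_betw_strict_mono_card assms(1,2) by metis
  then show ?thesis
    using assms(3) card_onto_avoiders_image by (metis bij_betw_imp_surj_on)
qed

lemma f0_words_eq_sum:
  "f0 v (words k n) = (\<Sum>S\<in>Pow {1..k}. card (onto_avoiders v S n))"
proof -
  have "{w \<in> words k n. \<not> (\<exists>js. occurrence v w js)} = (\<Union>S\<in>Pow {1..k}. onto_avoiders v S n)"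
    by (auto simp: words_def onto_avoiders_def)
  moreover have "card (\<Union>S\<in>Pow {1..k}. onto_avoiders v S n)
      = (\<Sum>S\<in>Pow {1..k}. card (onto_avoiders v S n))"
    by (intro card_UN_disjoint ballI finite_onto_avoiders)
      (auto simp: onto_avoiders_def intro: finite_subset)
  ultimately show ?thesis
    by (simp add: f0_def)
qed

text \<open>A word of length \<open>n\<close> that uses \<open>n\<close> different letters repeats
  none of them.\<close>

lemma f0_perms_eq: "f0 v (perms n) = card (onto_avoiders v {1..n} n)"
proof -
  have "{w \<in> perms n. \<not> (\<exists>js. occurrence v w js)} = onto_avoiders v {1..n} n"
    by (auto simp: perms_def permutations_of_set_def onto_avoiders_def
        dest: distinct_card intro: card_distinct)
  then show ?thesis
    by (simp add: f0_def)
qed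

text \<open>Only the full letter set \<open>{1..k}\<close> escapes the smaller cases, so its term is
  the total minus a sum on which both patterns agree. The length \<open>n\<close> stays
  fixed.\<close>

lemma card_onto_avoiders_eq_of_f0_words_eq:
  assumes "\<And>k. f0 v1 (words k n) = f0 v2 (words k n)"
  shows "card (onto_avoiders v1 {1..k} n) = card (onto_avoiders v2 {1..k} n)"
proof (induction k rule: less_induct)
  case (less k)
  have "card (onto_avoiders v1 S n) = card (onto_avoiders v2 S n)"
    if S: "S \<in> Pow {1..k} - {{1..k}}" for S
  proof -
    have fin: "finite S" and "card S < k"
      using S psubset_card_mono[of "{1..k}" S] by (auto intro: finite_subset)
    \<comment> \<open>The induction hypothesis speaks of \<open>{1..card S}\<close>, which has as
      many avoiders as \<open>S\<close> for either pattern.\<close>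
    then show ?thesis
      using less.IH card_onto_avoiders_cong[of S "{1..card S}"] by simp
  qed
  then have "(\<Sum>S\<in>Pow {1..k} - {{1..k}}. card (onto_avoiders v1 S n))
      = (\<Sum>S\<in>Pow {1..k} - {{1..k}}. card (onto_avoiders v2 S n))"
    by (rule sum.cong[OF refl])
  moreover have "f0 v (words k n) = card (onto_avoiders v {1..k} n)
      + (\<Sum>S\<in>Pow {1..k} - {{1..k}}. card (onto_avoiders v S n))" for v
    unfolding f0_words_eq_sum by (rule sum.remove) auto
  ultimately show ?case
    using assms[of k] by simp
qed

lemma f0_perms_eq_of_f0_words_eq:
  assumes "\<And>k. k \<ge> 1 \<Longrightarrow> f0 v1 (words k n) = f0 v2 (words k n)" and "n \<ge> 1"
  shows "f0 v1 (perms n) = f0 v2 (perms n)"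
proof -
  \<comment> \<open>The induction also needs \<open>k = 0\<close>, which the assumption excludes;
    with \<open>n \<ge> 1\<close> the empty word does not interfere and both counts vanish.\<close>
  have "words 0 n = {}"
    using \<open>n \<ge> 1\<close> by (auto simp: words_def)
  then have "f0 v1 (words k n) = f0 v2 (words k n)" for k
    using assms(1)[of k] by (cases k) (simp_all add: f0_def)
  then show ?thesis
    unfolding f0_perms_eq by (rule card_onto_avoiders_eq_of_f0_words_eq)
qed

text \<open>Equal letters of \<open>v\<close> force equal letters of \<open>w\<close>, at different
  positions because \<open>js\<close> is strictly increasing.\<close>

lemma occurrence_not_distinct:
  assumes "occurrence v w js" "\<not> distinct v"
  shows "\<not> distinct w"
proof -
  obtain p q where pq: "p < length v" "q < length v" "p \<noteq> q" "v ! p = v ! q"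
    using \<open>\<not> distinct v\<close> by (auto simp: distinct_conv_nth)
  have js: "length js = length v" "sorted_wrt (<) js" "set js \<subseteq> {..<length w}"
    and "w ! (js ! p) = w ! (js ! q)"
    using assms(1) pq unfolding occurrence_def by auto
  moreover have "js ! p \<noteq> js ! q"
    using js(1,2) pq(1-3) by (auto simp: strict_sorted_iff nth_eq_iff_index_eq)
  moreover have "js ! p < length w" "js ! q < length w"
    using js pq(1,2) nth_mem[of p js] nth_mem[of q js] by (metis lessThan_iff subsetD)+
  ultimately show ?thesis
    by (auto simp: distinct_conv_nth)
qed

lemma f0_perms_not_distinct:
  assumes "\<not> distinct v"
  shows "f0 v (perms n) = fact n"
proof -
  have "{w \<in> perms n. \<not> (\<exists>js. occurrence v w js)} = perms n"
    using occurrence_not_distinct[OF _ assms] by (auto simp: perms_def permutations_of_set_def)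
  then show ?thesis
    by (simp add: f0_def perms_def)
qed

lemma occurrence_length_le:
  assumes "occurrence v w js"
  shows "length v \<le> length w"
proof -
  have "distinct js" "length js = length v" "set js \<subseteq> {..<length w}"
    using assms by (auto simp: occurrence_def strict_sorted_iff)
  then show ?thesis
    using card_mono[of "{..<length w}" "set js"] by (simp add: distinct_card)
qed

lemma words_one: "words 1 n = {replicate n 1}"
  by (auto simp: words_def intro!: replicate_eqI)

theorem corollary3:
  shows "(\<forall>v1 v2. is_pattern v1 \<and> is_pattern v2 \<and>
            (\<forall>k\<ge>1. \<forall>n\<ge>1. f0 v1 (words k n) = f0 v2 (words k n)) \<longrightarrow>
            (\<forall>n\<ge>1. f0 v1 (perms n) = f0 v2 (perms n)))
       \<and> (\<exists>v1 v2. is_pattern v1 \<and> is_pattern v2 \<and>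
            (\<forall>n\<ge>1. f0 v1 (perms n) = f0 v2 (perms n)) \<and>
            (\<exists>k\<ge>1. \<exists>n\<ge>1. f0 v1 (words k n) \<noteq> f0 v2 (words k n)))"
proof (rule conjI)
  show "\<forall>v1 v2. is_pattern v1 \<and> is_pattern v2 \<and>
            (\<forall>k\<ge>1. \<forall>n\<ge>1. f0 v1 (words k n) = f0 v2 (words k n)) \<longrightarrow>
            (\<forall>n\<ge>1. f0 v1 (perms n) = f0 v2 (perms n))"
    using f0_perms_eq_of_f0_words_eq by blast
next
  \<comment> \<open>With \<open>k = 1\<close> and \<open>n = 2\<close> there is a single word: it
    contains the shorter pattern and is too short for the longer one.\<close>
  have word: "words 1 2 = {[1, 1]}"
    using words_one[of 2] by (simp add: numeral_2_eq_2)
  have "occurrence [1, 1] [1, 1] [0, 1]"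
    by (auto simp: occurrence_def less_Suc_eq numeral_2_eq_2)
  then have "{w \<in> words 1 2. \<not> (\<exists>js. occurrence [1, 1] w js)} = {}"
    unfolding word by blast
  then have "f0 [1, 1] (words 1 2) = 0"
    unfolding f0_def by (simp only: card.empty)
  moreover have "{w \<in> words 1 2. \<not> (\<exists>js. occurrence [1, 1, 1] w js)} = {[1, 1]}"
    unfolding word using occurrence_length_le[of "[1, 1, 1]" "[1, 1]"] by auto
  then have "f0 [1, 1, 1] (words 1 2) = 1"
    unfolding f0_def by simp
  ultimately have "f0 [1, 1] (words 1 2) \<noteq> f0 [1, 1, 1] (words 1 2)"
    by simp
  moreover have "f0 [1, 1] (perms n) = f0 [1, 1, 1] (perms n)" for n
    by (simp add: f0_perms_not_distinct)
  moreover have "is_pattern [1, 1]" "is_pattern [1, 1, 1]"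
    by (simp_all add: is_pattern_def)
  ultimately show "\<exists>v1 v2. is_pattern v1 \<and> is_pattern v2 \<and>
            (\<forall>n\<ge>1. f0 v1 (perms n) = f0 v2 (perms n)) \<and>
            (\<exists>k\<ge>1. \<exists>n\<ge>1. f0 v1 (words k n) \<noteq> f0 v2 (words k n))"
    by (metis le_numeral_extra(4) one_le_numeral)
qed

end
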